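(* (i) For $p=-2$, there exists a positive function $f\in C^\alpha(\mathbb{S}^1)$, $\alpha\in(0,1)$, such that the equation $$h_{\theta\theta}+h=f\,h^{p-1}\quad\text{on }\mathbb{S}^1$$ admits no positive classical solution. (ii) For every $p<-2$, there exists a Hölder continuous function $f$ on $\mathbb{S}^1$ which is positive outside two poles (two antipodal points) of $\mathbb{S}^1$, such that the same equation $h_{\theta\theta}+h=f\,h^{p-1}$ on $\mathbb{S}^1$ admits no positive classical solution.
   Context: $\mathbb{S}^1$ is the unit circle with arc-length parameter $\theta$; functions on $\mathbb{S}^1$ are identified with $2\pi$-periodic functions of $\theta$. A positive classical solution, for $f\in C^\alpha(\mathbb{S}^1)$ with $\alpha\in(0,1)$, is a function $h\in C^{2,\alpha}(\mathbb{S}^1)$ with $h>0$ everywhere satisfying the equation pointwise. *)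

theory Defs
  imports "HOL-Analysis.Analysis"
begin

text \<open>
  Functions on the unit circle are rendered as \<open>2\<pi>\<close>-periodic functions of the arc-length
  parameter. For such a function, the Hoelder estimate below over all real pairs is the Hoelder
  estimate with respect to arc-length distance on the circle (with the same constant), since that
  distance is the minimum of \<open>\<bar>x - y\<bar>\<close> over all lifts. Sup-norm bounds on a function and its
  derivatives need not be imposed: they follow from continuity and periodicity.
\<close>

definition circle_function :: "(real \<Rightarrow> real) \<Rightarrow> bool" where
  "circle_function f \<longleftrightarrow> (\<forall>x. f (x + 2 * pi) = f x)"

definition C_holder :: "real \<Rightarrow> (real \<Rightarrow> real) set" where
  "C_holder \<alpha> = {f. circle_function f \<and> (\<exists>C. \<forall>x y. \<bar>f x - f y\<bar> \<le> C * \<bar>x - y\<bar> powr \<alpha>)}"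

definition C2_holder :: "real \<Rightarrow> (real \<Rightarrow> real) set" where
  "C2_holder \<alpha> = {h. circle_function h \<and>
     (\<forall>x. h field_differentiable at x) \<and> (\<forall>x. deriv h field_differentiable at x) \<and>
     deriv (deriv h) \<in> C_holder \<alpha>}"

definition positive_classical_solution ::
    "real \<Rightarrow> real \<Rightarrow> (real \<Rightarrow> real) \<Rightarrow> (real \<Rightarrow> real) \<Rightarrow> bool" where
  "positive_classical_solution \<alpha> p f h \<longleftrightarrow>
     h \<in> C2_holder \<alpha> \<and> (\<forall>x. h x > 0) \<and>
     (\<forall>x. deriv (deriv h) x + h x = f x * h x powr (p - 1))"

text \<open>The lifts of the antipodal pair through the angle \<open>\<theta>\<^sub>0\<close>.\<close>

definition antipodal_poles :: "real \<Rightarrow> real set" where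
  "antipodal_poles \<theta>\<^sub>0 = {\<theta>\<^sub>0 + of_int k * pi | k. True}"

end

theory Submission
  imports Defs
begin

text \<open>
  The proof is a Kazdan--Warner type obstruction. Put \<open>\<xi> = sin (2\<theta>)\<close>, so that
  \<open>\<xi>''' + 4 \<xi>' = 0\<close>. For a positive solution \<open>h\<close> the periodic function
  \<open>W = \<xi> (h'\<^sup>2 - h\<^sup>2) / 2 - \<xi>' h h' / 2 - f \<xi> h\<^sup>p / p\<close>
  satisfies \<open>W' = - h\<^sup>p (f' \<xi> + (1 + p/2) f \<xi>') / p\<close>. Hence there is no solution as soon as
  \<open>p < 0\<close> and \<open>f' \<xi> + (1 + p/2) f \<xi>'\<close> is nonnegative and not identically zero. For
  \<open>p = -2\<close> the function \<open>f = 1 + sin\<^sup>2 \<theta>\<close> qualifies, and for \<open>p < -2\<close> so does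
  \<open>f = sin\<^sup>2\<^sup>m \<theta>\<close> with \<open>m\<close> large, whose zeros are the two poles \<open>0\<close> and \<open>\<pi>\<close>.
\<close>

lemma periodic_deriv:
  fixes h :: "real \<Rightarrow> real"
  assumes "\<And>x. h (x + c) = h x" and "\<And>x. h field_differentiable at x"
  shows "deriv h (x + c) = deriv h x"
proof -
  have "(h has_real_derivative deriv h (x + c)) (at (x + c))"
    using assms(2) field_differentiable_derivI by blast
  then have "((\<lambda>y. h (y + c)) has_real_derivative deriv h (x + c)) (at x)"
    by (simp add: DERIV_shift)
  then show ?thesis
    using assms(1) by (simp add: DERIV_imp_deriv)
qed

text \<open>Monotonicity traps \<open>W\<close> between its equal values at \<open>a\<close> and
  \<open>b\<close>, so \<open>W\<close> is constant there. An interior point has a whole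
  neighbourhood on which this applies.\<close>

lemma nonneg_deriv_returning_imp_zero_deriv:
  fixes W :: "real \<Rightarrow> real"
  assumes "\<And>x. (W has_real_derivative W' x) (at x)" and "\<And>x. W' x \<ge> 0"
    and "W b = W a" and "a < x" "x < b"
  shows "W' x = 0"
proof -
  have mono: "W s \<le> W t" if "s \<le> t" for s t
    using that assms(1,2) by (meson DERIV_nonneg_imp_nondecreasing)
  show ?thesis
  proof (rule DERIV_local_const[OF assms(1)])
    show "0 < min (x - a) (b - x)" using assms(4,5) by simp
    show "\<forall>y. \<bar>x - y\<bar> < min (x - a) (b - x) \<longrightarrow> W x = W y"
    proof (intro allI impI)
      fix y assume "\<bar>x - y\<bar> < min (x - a) (b - x)"
      then have "a \<le> y" "y \<le> b" by linarith+
      then show "W x = W y"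
        using mono[of a x] mono[of x b] mono[of a y] mono[of y b] assms(3-5) by linarith
    qed
  qed
qed

text \<open>The expression in \<open>nonneg\<close> is the one from the overview after inserting
  \<xi>' = 2 cos (2x). The point \<open>y\<close> lies inside one period, at whose ends
  \<open>W\<close> agrees.\<close>

lemma no_positive_solution:
  fixes f f' :: "real \<Rightarrow> real"
  assumes df: "\<And>x. (f has_real_derivative f' x) (at x)"
    and "p < 0"
    and nonneg: "\<And>x. f' x * sin (2 * x) + (2 + p) * f x * cos (2 * x) \<ge> 0"
    and pos: "f' y * sin (2 * y) + (2 + p) * f y * cos (2 * y) > 0" "0 < y" "y < 2 * pi"
  shows "\<not> positive_classical_solution \<alpha> p f h"
proof
  assume "positive_classical_solution \<alpha> p f h"
  then have per: "\<And>x. h (x + 2 * pi) = h x"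
    and dh: "\<And>x. h field_differentiable at x"
    and ddh: "\<And>x. deriv h field_differentiable at x"
    and hpos: "\<And>x. h x > 0"
    and eq: "\<And>x. deriv (deriv h) x + h x = f x * h x powr (p - 1)"
    by (auto simp: positive_classical_solution_def C2_holder_def circle_function_def)
  note [derivative_intros] = dh[THEN field_differentiable_derivI, THEN DERIV_chain2]
    ddh[THEN field_differentiable_derivI, THEN DERIV_chain2] df[THEN DERIV_chain2]
  define W where "W = (\<lambda>x. sin (2 * x) * ((deriv h x)\<^sup>2 - (h x)\<^sup>2) / 2
    - cos (2 * x) * (h x * deriv h x) - f x * sin (2 * x) * h x powr p / p)"
  define W' where "W' = (\<lambda>x. - (1 / p) * h x powr p
    * (f' x * sin (2 * x) + (2 + p) * f x * cos (2 * x)))"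
  have dW: "(W has_real_derivative W' x) (at x)" for x
  proof -
    \<comment> \<open>Writing both h^p and h'' through \<open>u\<close> removes the real powers, so
      that \<open>?D = W' x\<close> becomes a rational identity. The equation for h enters only
      through \<open>h2\<close>.\<close>
    define u where "u = h x powr (p - 1)"
    have hp: "h x powr p = h x * u"
      using hpos[of x] powr_add[of "h x" 1 "p - 1"] by (simp add: u_def)
    have h2: "deriv (deriv h) x = f x * u - h x"
      using eq[of x] by (simp add: u_def)
    have "(W has_real_derivative
        (2 * cos (2 * x) * ((deriv h x)\<^sup>2 - (h x)\<^sup>2) / 2
         + sin (2 * x) * (2 * deriv h x * deriv (deriv h) x - 2 * h x * deriv h x) / 2
         - (- 2 * sin (2 * x) * (h x * deriv h x)
            + cos (2 * x) * (deriv h x * deriv h x + h x * deriv (deriv h) x))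
         - ((f' x * sin (2 * x) + f x * (2 * cos (2 * x))) * h x powr p
            + f x * sin (2 * x) * (p * u * deriv h x)) / p)) (at x)"
      (is "(W has_real_derivative ?D) _")
      unfolding W_def u_def using hpos[of x] \<open>p < 0\<close>
      by (auto intro!: derivative_eq_intros simp: powr_diff field_simps power2_eq_square)
    moreover have "?D = W' x"
      unfolding W'_def hp h2 using \<open>p < 0\<close> by (simp add: field_simps power2_eq_square)
    ultimately show ?thesis by simp
  qed
  have "h (2 * pi) = h 0" "deriv h (2 * pi) = deriv h 0"
    using per[of 0] periodic_deriv[OF per dh, of 0] by simp_all
  then have "W (2 * pi) = W 0"
    using sin_periodic[of "2 * pi"] cos_periodic[of "2 * pi"] by (simp add: W_def)
  moreover have "W' x \<ge> 0" for x
    unfolding W'_def using nonneg[of x] \<open>p < 0\<close> by (intro mult_nonneg_nonneg) auto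
  ultimately have "W' y = 0"
    using nonneg_deriv_returning_imp_zero_deriv[OF dW] pos(2,3) by blast
  then show False
    using pos(1) \<open>p < 0\<close> hpos[of y] by (simp add: W'_def)
qed

text \<open>For distances t \<le> 1 the Lipschitz bound suffices because t \<le> t^\<alpha>; for
  larger t the oscillation is at most 2M and t^\<alpha> \<ge> 1. The constant L + 2M serves both
  ranges.\<close>

lemma bounded_Lipschitz_imp_C_holder:
  assumes "circle_function f" and "\<And>x. \<bar>f x\<bar> \<le> M"
    and "\<And>x y. \<bar>f x - f y\<bar> \<le> L * \<bar>x - y\<bar>" and "0 < \<alpha>" "\<alpha> < 1"
  shows "f \<in> C_holder \<alpha>"
proof -
  have "0 \<le> M" using assms(2)[of 0] by linarith
  have "0 \<le> L" using assms(3)[of 1 0] by simp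
  have "\<bar>f x - f y\<bar> \<le> (L + 2 * M) * \<bar>x - y\<bar> powr \<alpha>" for x y
  proof (cases "\<bar>x - y\<bar> \<le> 1")
    case True
    then have "\<bar>x - y\<bar> \<le> \<bar>x - y\<bar> powr \<alpha>"
      using powr_mono'[of \<alpha> 1 "\<bar>x - y\<bar>"] \<open>\<alpha> < 1\<close> by simp
    then have "L * \<bar>x - y\<bar> \<le> (L + 2 * M) * \<bar>x - y\<bar> powr \<alpha>"
      using \<open>0 \<le> L\<close> \<open>0 \<le> M\<close> by (intro mult_mono) auto
    then show ?thesis using assms(3)[of x y] by linarith
  next
    case False
    then have "1 \<le> \<bar>x - y\<bar> powr \<alpha>"
      using \<open>0 < \<alpha>\<close> by (intro ge_one_powr_ge_zero) auto
    then have "2 * M * 1 \<le> (L + 2 * M) * \<bar>x - y\<bar> powr \<alpha>"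
      using \<open>0 \<le> L\<close> \<open>0 \<le> M\<close> by (intro mult_mono) auto
    then show ?thesis using assms(2)[of x] assms(2)[of y] by linarith
  qed
  then show ?thesis
    using assms(1) by (auto simp: C_holder_def)
qed

lemma sin_power_derivative:
  "((\<lambda>x::real. c + sin x ^ (2 * Suc n)) has_real_derivative
     2 * real (Suc n) * (sin x ^ (2 * n + 1) * cos x)) (at x)"
  by (rule DERIV_cong[OF DERIV_add[OF DERIV_const DERIV_power[OF DERIV_sin]]]) simp

lemma sin_power_C_holder:
  fixes c :: real
  assumes "0 < \<alpha>" "\<alpha> < 1"
  shows "(\<lambda>x. c + sin x ^ (2 * Suc n)) \<in> C_holder \<alpha>"
proof (rule bounded_Lipschitz_imp_C_holder[OF _ _ _ assms])
  let ?f = "\<lambda>x::real. c + sin x ^ (2 * Suc n)"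
  show "circle_function ?f" by (simp add: circle_function_def)
  show "\<bar>?f x\<bar> \<le> \<bar>c\<bar> + 1" for x
  proof -
    have "\<bar>sin x ^ (2 * Suc n)\<bar> \<le> 1"
      unfolding power_abs by (intro power_le_one) auto
    then show ?thesis by linarith
  qed
  show "\<bar>?f x - ?f y\<bar> \<le> 2 * real (Suc n) * \<bar>x - y\<bar>" for x y
  proof -
    have "norm (2 * real (Suc n) * (sin z ^ (2 * n + 1) * cos z)) \<le> 2 * real (Suc n)" for z
    proof -
      have "\<bar>sin z\<bar> ^ (2 * n + 1) * \<bar>cos z\<bar> \<le> 1"
        by (intro mult_le_one power_le_one) auto
      then have "2 * real (Suc n) * (\<bar>sin z\<bar> ^ (2 * n + 1) * \<bar>cos z\<bar>) \<le> 2 * real (Suc n)"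
        by (intro mult_left_le) auto
      then show ?thesis by (simp add: abs_mult power_abs)
    qed
    then have "norm (?f x - ?f y) \<le> 2 * real (Suc n) * norm (x - y)"
      using sin_power_derivative
      by (intro field_differentiable_bound[of UNIV ?f]) auto
    then show ?thesis by simp
  qed
qed

text \<open>The condition \<open>(2 + p) * c = 0\<close> covers both uses: p = -2 with c = 1, and p
  < -2 with c = 0. It removes c from the obstruction, which then factors as an even power of sin
  times a combination of cos^2 and sin^2. The bound on n makes the cos^2 coefficient nonnegative,
  and p \<le> -2 does so for sin^2.\<close>

lemma sin_power_no_positive_solution:
  assumes "p \<le> -2" and "(2 + p) * c = 0" and "- (2 + p) \<le> 2 * real (Suc n)"
  shows "\<not> positive_classical_solution \<alpha> p (\<lambda>x. c + sin x ^ (2 * Suc n)) h"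
proof -
  let ?f = "\<lambda>x::real. c + sin x ^ (2 * Suc n)"
  let ?f' = "\<lambda>x::real. 2 * real (Suc n) * (sin x ^ (2 * n + 1) * cos x)"
  have key: "?f' x * sin (2 * x) + (2 + p) * ?f x * cos (2 * x) =
      sin x ^ (2 * Suc n) * ((4 * real (Suc n) + (2 + p)) * (cos x)\<^sup>2 - (2 + p) * (sin x)\<^sup>2)"
    for x
  proof -
    have "(2 + p) * ?f x = (2 + p) * sin x ^ (2 * Suc n)"
      using assms(2) by (simp only: distrib_left)
    then show ?thesis
      by (simp only: sin_double cos_double) (simp add: algebra_simps power2_eq_square)
  qed
  show ?thesis
  \<comment> \<open>At pi/4 the factor cos (2y) vanishes and sin (2y) = 1, so only the positive
    derivative of the sine power remains.\<close>
  proof (rule no_positive_solution[OF sin_power_derivative, where y = "pi / 4"])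
    show "p < 0" using assms(1) by simp
    show "?f' x * sin (2 * x) + (2 + p) * ?f x * cos (2 * x) \<ge> 0" for x
    proof -
      have "(4 * real (Suc n) + (2 + p)) * (cos x)\<^sup>2 \<ge> 0" "(2 + p) * (sin x)\<^sup>2 \<le> 0"
        using assms(1,3) by (auto intro!: mult_nonneg_nonneg mult_nonpos_nonneg)
      then show ?thesis
        unfolding key by (intro mult_nonneg_nonneg zero_le_even_power) auto
    qed
    have "sin (pi / 4) > 0" by (intro sin_gt_zero) auto
    then show "?f' (pi / 4) * sin (2 * (pi / 4)) + (2 + p) * ?f (pi / 4) * cos (2 * (pi / 4)) > 0"
      by (simp add: cos_45)
  qed auto
qed

theorem theorem1p4:
  shows "(\<forall>\<alpha>::real. 0 < \<alpha> \<and> \<alpha> < 1 \<longrightarrow>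
           (\<exists>f \<in> C_holder \<alpha>. (\<forall>x. f x > 0) \<and>
              \<not> (\<exists>h. positive_classical_solution \<alpha> (-2) f h)))
       \<and> (\<forall>p::real. p < -2 \<longrightarrow>
           (\<exists>\<alpha>. 0 < \<alpha> \<and> \<alpha> < 1 \<and>
             (\<exists>f \<in> C_holder \<alpha>. (\<exists>\<theta>\<^sub>0. \<forall>x. x \<notin> antipodal_poles \<theta>\<^sub>0 \<longrightarrow> f x > 0) \<and>
                \<not> (\<exists>h. positive_classical_solution \<alpha> p f h))))"
proof (intro conjI allI impI)
  fix \<alpha> :: real assume "0 < \<alpha> \<and> \<alpha> < 1"
  show "\<exists>f \<in> C_holder \<alpha>. (\<forall>x. f x > 0) \<and>
          \<not> (\<exists>h. positive_classical_solution \<alpha> (-2) f h)"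
  proof (intro bexI conjI allI)
    let ?f = "\<lambda>x::real. 1 + sin x ^ (2 * Suc 0)"
    show "?f \<in> C_holder \<alpha>" using \<open>0 < \<alpha> \<and> \<alpha> < 1\<close> sin_power_C_holder by blast
    show "?f x > 0" for x by (simp add: add_pos_nonneg)
    show "\<not> (\<exists>h. positive_classical_solution \<alpha> (-2) ?f h)"
      using sin_power_no_positive_solution[of "-2" 1 0 \<alpha>] by auto
  qed
next
  fix p :: real assume "p < -2"
  obtain n where n: "- (2 + p) \<le> real n" using real_arch_simple by blast
  \<comment> \<open>The summand 0 keeps the shape of the sine-power lemmas, with c = 0.\<close>
  let ?f = "\<lambda>x::real. 0 + sin x ^ (2 * Suc n)"
  have "?f \<in> C_holder (1/2)" by (intro sin_power_C_holder) auto
  moreover have "?f x > 0" if "x \<notin> antipodal_poles 0" for x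
  proof -
    have "sin x \<noteq> 0" using that by (auto simp: antipodal_poles_def sin_zero_iff_int2)
    \<comment> \<open>As a power of sin^2, \<open>?f x\<close> is positive wherever sin does not
      vanish.\<close>
    then show ?thesis unfolding power_mult by simp
  qed
  moreover have "\<not> (\<exists>h. positive_classical_solution (1/2) p ?f h)"
    using sin_power_no_positive_solution[of p 0 n "1/2"] n \<open>p < -2\<close> by auto
  ultimately show "\<exists>\<alpha>. 0 < \<alpha> \<and> \<alpha> < 1 \<and>
      (\<exists>f \<in> C_holder \<alpha>. (\<exists>\<theta>\<^sub>0. \<forall>x. x \<notin> antipodal_poles \<theta>\<^sub>0 \<longrightarrow> f x > 0) \<and>
         \<not> (\<exists>h. positive_classical_solution \<alpha> p f h))"
    by (intro exI[of _ "1/2"] conjI bexI[of _ ?f] exI[of _ 0]) auto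
qed

end
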